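(* Let $\mathcal C$ be a closed convex cone in $\mathbb R^N$. Then $\mathcal C$ is CP admissible if and only if there exist four disjoint index subsets $\mathcal I_1,\mathcal I_+,\mathcal I_-,\mathcal I_0$ (some of which can be empty) whose union is $\{1,\ldots,N\}$ such that $\mathcal C=\mathbb R^{\mathcal I_1}+(\mathbb R_+)^{\mathcal I_+}+(\mathbb R_-)^{\mathcal I_-}+\{0\}^{\mathcal I_0}$, or equivalently $\mathcal C=\mathbb R_{\mathcal I_1}\times(\mathbb R_+)_{\mathcal I_+}\times(\mathbb R_-)_{\mathcal I_-}\times\{0\}_{\mathcal I_0}$.
   Context: Cones are assumed to contain the zero vector. For $x\in\mathbb R^N$, $\mathrm{supp}(x)=\{i: x_i\ne0\}$. For an index set $\mathcal I\subseteq\{1,\dots,N\}$, $\pi_{\mathcal I}:\mathbb R^N\to\mathbb R^N$ keeps the coordinates in $\mathcal I$ and sets all others to $0$. A nonempty set $\mathcal P\subseteq\mathbb R^N$ is coordinate projection admissible (CP admissible) if for any $x\in\mathcal P$ and any $\mathcal J\subseteq\mathrm{supp}(x)$ (possibly empty), $\pi_{\mathcal J}(x)\in\mathcal P$. For nonempty $\mathcal U\subseteq\mathbb R$ and an index set $\mathcal I$: $\mathcal U^{\mathcal I}:=\{x\in\mathbb R^N : x_i\in\mathcal U\ \forall i\in\mathcal I,\ x_i=0\ \forall i\notin\mathcal I\}$ and $\mathcal U_{\mathcal I}:=\{u\in\mathbb R^{|\mathcal I|} : u_i\in\mathcal U\ \forall i\in\mathcal I\}$; in the Cartesian product, the factor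 with subscript $\mathcal I$ occupies the coordinates in $\mathcal I$. $\mathbb R_+=[0,\infty)$, $\mathbb R_-=(-\infty,0]$. *)

theory Defs
  imports "HOL-Analysis.Analysis"
begin

text \<open>
  The space is \<open>real ^ 'n\<close>; the index set \<open>{1,\<dots>,N}\<close> is \<open>UNIV :: 'n set\<close>.
\<close>

definition vec_supp :: "real ^ 'n \<Rightarrow> 'n set" where
  "vec_supp x = {i. x $ i \<noteq> 0}"

definition coord_proj :: "'n set \<Rightarrow> real ^ 'n \<Rightarrow> real ^ 'n" where
  "coord_proj I x = (\<chi> i. if i \<in> I then x $ i else 0)"

definition cp_admissible :: "(real ^ 'n) set \<Rightarrow> bool" where
  "cp_admissible P \<longleftrightarrow>
     P \<noteq> {} \<and> (\<forall>x\<in>P. \<forall>J. J \<subseteq> vec_supp x \<longrightarrow> coord_proj J x \<in> P)"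

text \<open>\<open>U\<^sup>I\<close>, a subset of the full space.\<close>

definition coord_embed :: "real set \<Rightarrow> 'n set \<Rightarrow> (real ^ 'n) set" where
  "coord_embed U I = {x. (\<forall>i\<in>I. x $ i \<in> U) \<and> (\<forall>i. i \<notin> I \<longrightarrow> x $ i = 0)}"

text \<open>
  \<open>U\<^sub>I\<close>, a subset of the \<open>|I|\<close>-dimensional space. Vectors with coordinates
  indexed by \<open>I\<close> are represented as functions that are \<open>undefined\<close> outside \<open>I\<close>.
\<close>

definition coord_box :: "real set \<Rightarrow> 'n set \<Rightarrow> ('n \<Rightarrow> real) set" where
  "coord_box U I = (I \<rightarrow>\<^sub>E U)"

definition coord_block :: "'n set \<Rightarrow> real ^ 'n \<Rightarrow> 'n \<Rightarrow> real" where
  "coord_block I x = restrict (\<lambda>i. x $ i) I"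

text \<open>
  The Cartesian product \<open>A \<times> B \<times> C \<times> D\<close> of sets of vectors indexed by \<open>I\<close>, \<open>J\<close>, \<open>K\<close>, \<open>L\<close>,
  each factor occupying its own coordinates. It is meant for index sets that partition
  \<open>UNIV\<close>, where a vector amounts to its four blocks.
\<close>

definition block_product ::
  "'n set \<Rightarrow> ('n \<Rightarrow> real) set \<Rightarrow> 'n set \<Rightarrow> ('n \<Rightarrow> real) set \<Rightarrow>
   'n set \<Rightarrow> ('n \<Rightarrow> real) set \<Rightarrow> 'n set \<Rightarrow> ('n \<Rightarrow> real) set \<Rightarrow> (real ^ 'n) set" where
  "block_product I A J B K C L D =
     {x. coord_block I x \<in> A \<and> coord_block J x \<in> B \<and> coord_block K x \<in> C \<and> coord_block L x \<in> D}"

definition index_partition :: "'n set \<Rightarrow> 'n set \<Rightarrow> 'n set \<Rightarrow> 'n set \<Rightarrow> bool" where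
  "index_partition I J K L \<longleftrightarrow>
     I \<inter> J = {} \<and> I \<inter> K = {} \<and> I \<inter> L = {} \<and> J \<inter> K = {} \<and> J \<inter> L = {} \<and> K \<inter> L = {} \<and>
     I \<union> J \<union> K \<union> L = UNIV"

end

theory Submission
  imports Defs
begin

text \<open>
  For a coordinate \<open>i\<close>, a CP admissible cone contains together with \<open>x\<close> the vector \<open>x\<^sub>i e\<^sub>i\<close>, hence
  \<open>e\<^sub>i\<close> or \<open>-e\<^sub>i\<close> according to the sign of \<open>x\<^sub>i\<close>. So with \<open>P = {i. e\<^sub>i \<in> C}\<close> and
  \<open>M = {i. -e\<^sub>i \<in> C}\<close> every \<open>x \<in> C\<close> is positive only on \<open>P\<close> and negative only on \<open>M\<close>; conversely
  every such \<open>x\<close> is a conic combination of these vectors. The four index sets are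
  \<open>P \<inter> M\<close>, \<open>P - M\<close>, \<open>M - P\<close> and \<open>- (P \<union> M)\<close>.
\<close>

text \<open>Common normal form for the Minkowski sum and the block product. The coordinates of the
  \<open>\<real>\<close> factor are unconstrained, so their index set is not a parameter.\<close>

definition sign_orthant :: "'n set \<Rightarrow> 'n set \<Rightarrow> 'n set \<Rightarrow> (real ^ 'n) set" where
  "sign_orthant Ip In I0 =
     {x. (\<forall>i\<in>Ip. 0 \<le> x $ i) \<and> (\<forall>i\<in>In. x $ i \<le> 0) \<and> (\<forall>i\<in>I0. x $ i = 0)}"

lemma coord_proj_nth [simp]: "coord_proj I x $ i = (if i \<in> I then x $ i else 0)"
  by (simp add: coord_proj_def)

lemma coord_proj_singleton: "coord_proj {i} x = axis i (x $ i)"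
  by (simp add: vec_eq_iff axis_def)

lemma coord_proj_in_coord_embed:
  "(\<And>i. i \<in> I \<Longrightarrow> x $ i \<in> U) \<Longrightarrow> coord_proj I x \<in> coord_embed U I"
  by (simp add: coord_embed_def)

lemma sum_coord_proj_partition:
  assumes "index_partition I J K L"
  shows "coord_proj I x + coord_proj J x + coord_proj K x + coord_proj L x = x"
proof -
  have "(if i \<in> I then x $ i else 0) + (if i \<in> J then x $ i else 0)
      + (if i \<in> K then x $ i else 0) + (if i \<in> L then x $ i else 0) = x $ i" for i
  proof -
    have "i \<in> I \<union> J \<union> K \<union> L"
      using assms by (simp add: index_partition_def)
    then show ?thesis
      using assms unfolding index_partition_def by auto
  qed
  then show ?thesis
    by (simp add: vec_eq_iff)
qed

text \<open>By disjointness at most one of the four summands is nonzero at a given coordinate, so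
  the sum inherits the sign of that summand. Conversely, a vector splits into its projections onto
  the four index sets.\<close>

lemma sum_coord_embed_eq_sign_orthant:
  assumes "index_partition I1 Ip In I0"
  shows "coord_embed UNIV I1 + coord_embed {0..} Ip + coord_embed {..0} In + coord_embed {0} I0
    = sign_orthant Ip In I0" (is "?S = _")
proof
  show "?S \<subseteq> sign_orthant Ip In I0"
  proof
    fix x assume "x \<in> ?S"
    then obtain a b c d where x: "x = a + b + c + d"
      and mem: "a \<in> coord_embed UNIV I1" "b \<in> coord_embed {0..} Ip"
        "c \<in> coord_embed {..0} In" "d \<in> coord_embed {0} I0"
      by (elim set_plus_elim) blast
    have disj: "Ip \<inter> I1 = {}" "Ip \<inter> In = {}" "Ip \<inter> I0 = {}" "In \<inter> I1 = {}" "In \<inter> I0 = {}" "I0 \<inter> I1 = {}"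
      using assms by (auto simp: index_partition_def)
    have "0 \<le> x $ i" if "i \<in> Ip" for i
    proof -
      have "i \<notin> I1" "i \<notin> In" "i \<notin> I0" using that disj by auto
      then show ?thesis using mem that by (simp add: x coord_embed_def)
    qed
    moreover have "x $ i \<le> 0" if "i \<in> In" for i
    proof -
      have "i \<notin> I1" "i \<notin> Ip" "i \<notin> I0" using that disj by auto
      then show ?thesis using mem that by (simp add: x coord_embed_def)
    qed
    moreover have "x $ i = 0" if "i \<in> I0" for i
    proof -
      have "i \<notin> I1" "i \<notin> Ip" "i \<notin> In" using that disj by auto
      then show ?thesis using mem that by (simp add: x coord_embed_def)
    qed
    ultimately show "x \<in> sign_orthant Ip In I0"
      by (simp add: sign_orthant_def)
  qed
  show "sign_orthant Ip In I0 \<subseteq> ?S"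
  proof
    fix x assume x: "x \<in> sign_orthant Ip In I0"
    have "coord_proj I1 x + coord_proj Ip x + coord_proj In x + coord_proj I0 x \<in> ?S"
      by (intro set_plus_intro coord_proj_in_coord_embed) (use x in \<open>auto simp: sign_orthant_def\<close>)
    then show "x \<in> ?S"
      by (simp add: sum_coord_proj_partition[OF assms])
  qed
qed

lemma coord_block_in_coord_box: "coord_block I x \<in> coord_box U I \<longleftrightarrow> (\<forall>i\<in>I. x $ i \<in> U)"
  by (simp add: coord_block_def coord_box_def PiE_iff)

lemma block_product_eq_sign_orthant:
  "block_product I1 (coord_box UNIV I1) Ip (coord_box {0..} Ip)
     In (coord_box {..0} In) I0 (coord_box {0} I0) = sign_orthant Ip In I0"
  by (simp add: block_product_def coord_block_in_coord_box sign_orthant_def)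

text \<open>Each condition concerns a single coordinate and allows the value 0, so zeroing
  coordinates preserves it.\<close>

lemma cp_admissible_sign_orthant: "cp_admissible (sign_orthant Ip In I0)"
proof -
  have "0 \<in> sign_orthant Ip In I0"
    by (simp add: sign_orthant_def)
  then have "sign_orthant Ip In I0 \<noteq> {}"
    by blast
  then show ?thesis
    unfolding cp_admissible_def by (simp add: sign_orthant_def)
qed

text \<open>Reals of equal sign are nonnegative multiples of each other. This serves both to
  normalise \<open>axis i (x $ i)\<close> to a signed unit vector and to scale back.\<close>

lemma cone_axis_sgn:
  fixes C :: "(real ^ 'n) set"
  assumes "cone C" and "axis i a \<in> C" and "sgn c = sgn a"
  shows "axis i c \<in> C"
proof -
  have "\<exists>r\<ge>0. c = r * a"
    using assms(3)
    \<comment> \<open>The witness also covers \<open>a = 0\<close>: then \<open>c = 0\<close>, and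
      division by zero yields 0.\<close>
    by (intro exI[of _ "c / a"]) (auto simp: sgn_if zero_le_divide_iff split: if_splits)
  then obtain r where r: "0 \<le> r" "c = r * a"
    by blast
  have "r *\<^sub>R axis i a = axis i c"
    by (simp add: r vec_eq_iff axis_def)
  then show ?thesis
    using mem_cone[OF assms(1,2) r(1)] by simp
qed

text \<open>A convex cone is closed under addition; \<open>0 \<in> C\<close> handles the empty sum
  and the default value 0 of a sum over an infinite set.\<close>

lemma convex_cone_sum_mem:
  assumes "convex C" "cone C" "0 \<in> C" "\<And>i. i \<in> A \<Longrightarrow> f i \<in> C"
  shows "sum f A \<in> C"
  using assms(4)
  by (induction A rule: infinite_finite_induct) (use assms(1-3) convex_cone in auto)

lemma convex_cone_eq_sign_orthant:
  fixes C :: "(real ^ 'n) set"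
  assumes "convex C" "cone C" "0 \<in> C" and adm: "cp_admissible C"
  defines "P \<equiv> {i. axis i 1 \<in> C}" and "M \<equiv> {i. axis i (-1) \<in> C}"
  shows "C = sign_orthant (P - M) (M - P) (- (P \<union> M))"
proof
  show "C \<subseteq> sign_orthant (P - M) (M - P) (- (P \<union> M))"
  proof
    fix x assume x: "x \<in> C"
    \<comment> \<open>Admissibility is applied with \<open>J = {i}\<close>, which lies in the
      support because \<open>x $ i \<noteq> 0\<close>.\<close>
    have ax: "axis i (x $ i) \<in> C" if "x $ i \<noteq> 0" for i
      using adm x that unfolding cp_admissible_def coord_proj_singleton[symmetric]
      by (simp add: vec_supp_def)
    have pos: "i \<in> P" if "0 < x $ i" for i
      using cone_axis_sgn[OF \<open>cone C\<close> ax, of i 1] that by (simp add: P_def)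
    have neg: "i \<in> M" if "x $ i < 0" for i
      using cone_axis_sgn[OF \<open>cone C\<close> ax, of i "-1"] that by (simp add: M_def)
    show "x \<in> sign_orthant (P - M) (M - P) (- (P \<union> M))"
      unfolding sign_orthant_def mem_Collect_eq
    proof (intro conjI ballI)
      show "0 \<le> x $ i" if "i \<in> P - M" for i
        using neg[of i] that by (meson DiffD2 not_le)
      show "x $ i \<le> 0" if "i \<in> M - P" for i
        using pos[of i] that by (meson DiffD2 not_le)
      show "x $ i = 0" if "i \<in> - (P \<union> M)" for i
        using pos[of i] neg[of i] that by (meson ComplD UnI1 UnI2 linorder_neqE)
    qed
  qed
  show "sign_orthant (P - M) (M - P) (- (P \<union> M)) \<subseteq> C"
  proof
    fix x assume "x \<in> sign_orthant (P - M) (M - P) (- (P \<union> M))"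
    then have xP: "\<forall>i\<in>P - M. 0 \<le> x $ i" and xM: "\<forall>i\<in>M - P. x $ i \<le> 0"
      and x0: "\<forall>i\<in>- (P \<union> M). x $ i = 0"
      unfolding sign_orthant_def by blast+
    \<comment> \<open>An index outside \<open>M\<close> lies in \<open>P - M\<close> or outside
      \<open>P \<union> M\<close>; either way the coordinate is nonnegative. The next claim is
      symmetric.\<close>
    have nonneg: "0 \<le> x $ i" if "i \<notin> M" for i
      using xP x0 that by (metis Compl_iff DiffI UnE order_refl)
    have nonpos: "x $ i \<le> 0" if "i \<notin> P" for i
      using xM x0 that by (metis Compl_iff DiffI UnE order_refl)
    have "axis i (x $ i) \<in> C" for i
    proof (cases "x $ i" "0::real" rule: linorder_cases)
      case less
      then have "i \<in> M"
        using nonneg[of i] by force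
      then show ?thesis
        using less cone_axis_sgn[OF \<open>cone C\<close>, of i "-1"] by (simp add: M_def)
    next
      case equal
      then show ?thesis
        using \<open>0 \<in> C\<close> axis_eq_0_iff[of i "x $ i"] by metis
    next
      case greater
      then have "i \<in> P"
        using nonpos[of i] by force
      then show ?thesis
        using greater cone_axis_sgn[OF \<open>cone C\<close>, of i 1] by (simp add: P_def)
    qed
    then have "(\<Sum>i\<in>UNIV. axis i (x $ i)) \<in> C"
      by (intro convex_cone_sum_mem assms)
    moreover have "(\<Sum>i\<in>UNIV. axis i (x $ i)) = x"
      by (simp add: vec_eq_iff axis_def)
    ultimately show "x \<in> C"
      by simp
  qed
qed

theorem proposition4p2:
  fixes C :: "(real ^ 'n) set"
  assumes "closed C" and "convex C" and "cone C" and "0 \<in> C"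
  shows "(cp_admissible C \<longleftrightarrow>
           (\<exists>I1 Ip Im I0. index_partition I1 Ip Im I0 \<and>
              C = coord_embed UNIV I1 + coord_embed {0..} Ip
                  + coord_embed {..0} Im + coord_embed {0} I0)) \<and>
         (\<forall>I1 Ip Im I0. index_partition I1 Ip Im I0 \<longrightarrow>
            (C = coord_embed UNIV I1 + coord_embed {0..} Ip
                 + coord_embed {..0} Im + coord_embed {0} I0 \<longleftrightarrow>
             C = block_product I1 (coord_box UNIV I1) Ip (coord_box {0..} Ip)
                               Im (coord_box {..0} Im) I0 (coord_box {0} I0)))"
    (is "(_ \<longleftrightarrow> ?decomposes) \<and> _")
proof (intro conjI iffI allI impI)
  assume adm: "cp_admissible C"
  define P where "P = {i. axis i 1 \<in> C}"
  define M where "M = {i. axis i (-1) \<in> C}"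
  have part: "index_partition (P \<inter> M) (P - M) (M - P) (- (P \<union> M))"
    by (auto simp: index_partition_def)
  moreover have "C = sign_orthant (P - M) (M - P) (- (P \<union> M))"
    unfolding P_def M_def by (rule convex_cone_eq_sign_orthant[OF assms(2-4) adm])
  ultimately show ?decomposes
    using sum_coord_embed_eq_sign_orthant[OF part] by metis
next
  assume ?decomposes
  then show "cp_admissible C"
    using sum_coord_embed_eq_sign_orthant cp_admissible_sign_orthant by metis
\<comment> \<open>What remains is the equivalence of the two representations: both right-hand sides
  equal the same sign orthant.\<close>
qed (simp_all add: sum_coord_embed_eq_sign_orthant block_product_eq_sign_orthant)

end
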